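(* Let $X=\{X_t, t\in T\}$ be a stationary real-valued random field, and let $z\in\{\alpha,\beta,\phi,\psi,\rho\}$ be one of the mixing types. Suppose that the $z$-mixing rate of $X$ satisfies $\int_T z_X(\|t\|,1,1)\,dt<+\infty$. Then $X$ is short range dependent, and for every finite measure $\mu$ on $\mathbb{R}$ $$\int_T\int_{\mathbb{R}^2}|\mathrm{Cov}_X(t,u,v)|\,\mu(du)\,\mu(dv)\,dt\le 8\int_T z_X(\|t\|,1,1)\,dt\cdot\mu^2(\mathbb{R})<+\infty .$$
   Context: $T$ is an unbounded subset of $\mathbb{R}^d$, $d\ge 1$ (with $0\in T$); $\|\cdot\|$ is a norm on $\mathbb{R}^d$; $(\Omega,\mathcal F,P)$ is the underlying probability space. For discrete index sets (say $T\subseteq\mathbb{Z}^d$), $\int_T\,dt$ is to be replaced by $\sum_{t\in T,\,t\ne 0}$; otherwise $dt$ is Lebesgue measure. For $t\in T$, $u,v\in\mathbb{R}$ put $\mathrm{Cov}_X(t,u,v)=\mathrm{Cov}(\mathbf 1(X_0>u),\mathbf 1(X_t>v))$. Definition. A stationary real-valued random field $X$ is called short range dependent (s.r.d.) if for every finite measure $\mu$ on $\mathbb{R}$ $$\sigma^2_{\mu,X}:=\int_T\int_{\mathbb{R}^2}|\mathrm{Cov}_X(t,u,v)|\,\mu(du)\,\mu(dv)\,dt<+\infty .$$ Mixing coefficients of two sub-$\sigma$-algebras $\mathcal U,\mathcal V\subset\mathcal F$: $\alpha(\mathcal U,\mathcal V)=\sup\{|P(U\cap V)-P(U)P(V)|:U\in\mathcal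 U,V\in\mathcal V\}$; $\beta(\mathcal U,\mathcal V)=\frac12\sup\sum_{i}\sum_j|P(U_i\cap V_j)-P(U_i)P(V_j)|$, the supremum over finite measurable partitions $(U_i)\subset\mathcal U$, $(V_j)\subset\mathcal V$ of $\Omega$; $\phi(\mathcal U,\mathcal V)=\sup\{|P(V)-P(U\cap V)/P(U)|:U\in\mathcal U,\ P(U)>0,\ V\in\mathcal V\}$; $\psi(\mathcal U,\mathcal V)=\sup\{|1-P(U\cap V)/(P(U)P(V))|:U\in\mathcal U,V\in\mathcal V,\ P(U)P(V)>0\}$; $\rho(\mathcal U,\mathcal V)=\sup\{|\mathrm{Corr}(\xi,\eta)|:\xi\in L^2(\mathcal U),\eta\in L^2(\mathcal V)\}$. For finite $C\subset T$ let $|C|$ be its cardinality and $\sigma_{X_C}$ the $\sigma$-algebra generated by $\{X_t,t\in C\}$. The $z$-mixing coefficient of $X$ is $$z_X(k,u,v)=\sup\{z(\sigma_{X_A},\sigma_{X_B}): d(A,B)\ge k,\ |A|\le u,\ |B|\le v\},\quad u,v\in\mathbb{N},$$ where $A,B\subset T$ are finite and $d(A,B)$ is the Hausdorff distance between $A$ and $B$ generated by the metric on $\mathbb{R}^d$. *)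

theory Defs
  imports "HOL-Probability.Probability" "HOL-Library.Disjoint_Sets"
begin

definition is_norm :: "('v::real_vector \<Rightarrow> real) \<Rightarrow> bool" where
  "is_norm N \<longleftrightarrow>
     (\<forall>x. N x = 0 \<longleftrightarrow> x = 0) \<and>
     (\<forall>c x. N (c *\<^sub>R x) = \<bar>c\<bar> * N x) \<and>
     (\<forall>x y. N (x + y) \<le> N x + N y)"

text \<open>Hausdorff distance in the metric \<open>(a, b) \<mapsto> N (a - b)\<close>. It is only used for finite nonempty
  sets, for which all infima and suprema below are attained.\<close>

definition hausdorff_distance :: "('v::real_vector \<Rightarrow> real) \<Rightarrow> 'v set \<Rightarrow> 'v set \<Rightarrow> real" where
  "hausdorff_distance N A B =
     max (SUP a\<in>A. INF b\<in>B. N (a - b)) (SUP b\<in>B. INF a\<in>A. N (a - b))"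

text \<open>Integration over the index set: the sum over \<open>T - {0}\<close> if \<open>T\<close> is discrete, the integral with
  respect to Lebesgue measure otherwise. The integrals are those of nonnegative functions, so they
  take values in \<open>[0, \<infinity>]\<close> and no integrability has to be assumed. The qualified name refers to
  discrete subsets of a topological space; the type constructor \<open>discrete\<close> of the probability
  library hides the short name.\<close>

definition index_integral :: "(real ^ 'n) set \<Rightarrow> (real ^ 'n \<Rightarrow> ennreal) \<Rightarrow> ennreal" where
  "index_integral T f =
     (if topological_space_class.discrete T then \<integral>\<^sup>+ t. f t \<partial>count_space (T - {0})
      else \<integral>\<^sup>+ t\<in>T. f t \<partial>lebesgue)"

definition covariance :: "'w measure \<Rightarrow> ('w \<Rightarrow> real) \<Rightarrow> ('w \<Rightarrow> real) \<Rightarrow> real" where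
  "covariance M \<xi> \<eta> =
     (\<integral>\<omega>. (\<xi> \<omega> - (\<integral>\<omega>'. \<xi> \<omega>' \<partial>M)) * (\<eta> \<omega> - (\<integral>\<omega>'. \<eta> \<omega>' \<partial>M)) \<partial>M)"

text \<open>Since \<open>x / 0 = 0\<close>, the correlation with an almost surely constant variable is \<open>0\<close>.\<close>

definition correlation :: "'w measure \<Rightarrow> ('w \<Rightarrow> real) \<Rightarrow> ('w \<Rightarrow> real) \<Rightarrow> real" where
  "correlation M \<xi> \<eta> = covariance M \<xi> \<eta> / sqrt (covariance M \<xi> \<xi> * covariance M \<eta> \<eta>)"

definition random_field :: "'w measure \<Rightarrow> 'i set \<Rightarrow> ('i \<Rightarrow> 'w \<Rightarrow> real) \<Rightarrow> bool" where
  "random_field M T X \<longleftrightarrow> (\<forall>t\<in>T. X t \<in> borel_measurable M)"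

text \<open>Strict stationarity: all finite-dimensional distributions are invariant under those shifts
  that keep the points inside the index set.\<close>

definition stationary_field ::
    "'w measure \<Rightarrow> (real ^ 'n) set \<Rightarrow> (real ^ 'n \<Rightarrow> 'w \<Rightarrow> real) \<Rightarrow> bool" where
  "stationary_field M T X \<longleftrightarrow>
     random_field M T X \<and>
     (\<forall>S h. finite S \<longrightarrow> S \<subseteq> T \<longrightarrow> (\<forall>s\<in>S. s + h \<in> T) \<longrightarrow>
        distr M (\<Pi>\<^sub>M s\<in>S. borel) (\<lambda>\<omega>. \<lambda>s\<in>S. X (s + h) \<omega>) =
        distr M (\<Pi>\<^sub>M s\<in>S. borel) (\<lambda>\<omega>. \<lambda>s\<in>S. X s \<omega>))"

definition Cov_field ::
    "'w measure \<Rightarrow> (real ^ 'n \<Rightarrow> 'w \<Rightarrow> real) \<Rightarrow> real ^ 'n \<Rightarrow> real \<Rightarrow> real \<Rightarrow> real" where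
  "Cov_field M X t u v =
     covariance M (\<lambda>\<omega>. of_bool (X 0 \<omega> > u)) (\<lambda>\<omega>. of_bool (X t \<omega> > v))"

definition sigma2 ::
    "'w measure \<Rightarrow> (real ^ 'n) set \<Rightarrow> (real ^ 'n \<Rightarrow> 'w \<Rightarrow> real) \<Rightarrow> real measure \<Rightarrow> ennreal" where
  "sigma2 M T X \<mu> =
     index_integral T (\<lambda>t. \<integral>\<^sup>+ (u, v). ennreal \<bar>Cov_field M X t u v\<bar> \<partial>(\<mu> \<Otimes>\<^sub>M \<mu>))"

definition short_range_dependent ::
    "'w measure \<Rightarrow> (real ^ 'n) set \<Rightarrow> (real ^ 'n \<Rightarrow> 'w \<Rightarrow> real) \<Rightarrow> bool" where
  "short_range_dependent M T X \<longleftrightarrow>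
     (\<forall>\<mu>. finite_borel_measure \<mu> \<longrightarrow> sigma2 M T X \<mu> < \<infinity>)"

text \<open>The sub-\<open>\<sigma>\<close>-algebras \<open>U\<close>, \<open>V\<close> of \<open>M\<close> are represented as measures on \<open>space M\<close>, of which only
  the measurable sets matter. The coefficients are \<open>[0, \<infinity>]\<close>-valued because \<open>\<psi>\<close> may be infinite.\<close>

definition alpha_mixing :: "'w measure \<Rightarrow> 'w measure \<Rightarrow> 'w measure \<Rightarrow> ennreal" where
  "alpha_mixing M U V =
     (SUP (A, B) \<in> sets U \<times> sets V. ennreal \<bar>measure M (A \<inter> B) - measure M A * measure M B\<bar>)"

definition beta_mixing :: "'w measure \<Rightarrow> 'w measure \<Rightarrow> 'w measure \<Rightarrow> ennreal" where
  "beta_mixing M U V =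
     (SUP (P, Q) \<in> {(P, Q). finite P \<and> P \<subseteq> sets U \<and> partition_on (space M) P \<and>
                            finite Q \<and> Q \<subseteq> sets V \<and> partition_on (space M) Q}.
        ennreal (\<Sum>A\<in>P. \<Sum>B\<in>Q. \<bar>measure M (A \<inter> B) - measure M A * measure M B\<bar>)) / 2"

definition phi_mixing :: "'w measure \<Rightarrow> 'w measure \<Rightarrow> 'w measure \<Rightarrow> ennreal" where
  "phi_mixing M U V =
     (SUP (A, B) \<in> {(A, B). A \<in> sets U \<and> measure M A > 0 \<and> B \<in> sets V}.
        ennreal \<bar>measure M B - measure M (A \<inter> B) / measure M A\<bar>)"

definition psi_mixing :: "'w measure \<Rightarrow> 'w measure \<Rightarrow> 'w measure \<Rightarrow> ennreal" where
  "psi_mixing M U V =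
     (SUP (A, B) \<in> {(A, B). A \<in> sets U \<and> B \<in> sets V \<and> measure M A * measure M B > 0}.
        ennreal \<bar>1 - measure M (A \<inter> B) / (measure M A * measure M B)\<bar>)"

definition rho_mixing :: "'w measure \<Rightarrow> 'w measure \<Rightarrow> 'w measure \<Rightarrow> ennreal" where
  "rho_mixing M U V =
     (SUP (\<xi>, \<eta>) \<in> {(\<xi>, \<eta>). \<xi> \<in> borel_measurable U \<and> integrable M (\<lambda>\<omega>. (\<xi> \<omega>)\<^sup>2) \<and>
                            \<eta> \<in> borel_measurable V \<and> integrable M (\<lambda>\<omega>. (\<eta> \<omega>)\<^sup>2)}.
        ennreal \<bar>correlation M \<xi> \<eta>\<bar>)"

datatype mixing_type = Alpha | Beta | Phi | Psi | Rho

primrec mixing_coeff :: "mixing_type \<Rightarrow> 'w measure \<Rightarrow> 'w measure \<Rightarrow> 'w measure \<Rightarrow> ennreal" where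
  "mixing_coeff Alpha = alpha_mixing"
| "mixing_coeff Beta = beta_mixing"
| "mixing_coeff Phi = phi_mixing"
| "mixing_coeff Psi = psi_mixing"
| "mixing_coeff Rho = rho_mixing"

definition field_sigma :: "'w measure \<Rightarrow> ('i \<Rightarrow> 'w \<Rightarrow> real) \<Rightarrow> 'i set \<Rightarrow> 'w measure" where
  "field_sigma M X C = sigma (space M) (\<Union>t\<in>C. {X t -` S \<inter> space M |S. S \<in> sets borel})"

text \<open>\<open>A\<close> and \<open>B\<close> range over nonempty sets, for which the Hausdorff distance is defined. An empty
  set would generate the trivial \<open>\<sigma>\<close>-algebra, whose mixing coefficients are \<open>0\<close>, so this does
  not affect the supremum.\<close>

definition field_mixing ::
    "mixing_type \<Rightarrow> (real ^ 'n \<Rightarrow> real) \<Rightarrow> 'w measure \<Rightarrow> (real ^ 'n) set \<Rightarrow> (real ^ 'n \<Rightarrow> 'w \<Rightarrow> real)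
      \<Rightarrow> real \<Rightarrow> nat \<Rightarrow> nat \<Rightarrow> ennreal" where
  "field_mixing z N M T X k u v =
     (SUP (A, B) \<in> {(A, B). A \<subseteq> T \<and> finite A \<and> A \<noteq> {} \<and> B \<subseteq> T \<and> finite B \<and> B \<noteq> {} \<and>
                            hausdorff_distance N A B \<ge> k \<and> card A \<le> u \<and> card B \<le> v}.
        mixing_coeff z M (field_sigma M X A) (field_sigma M X B))"

end

theory Submission
  imports Defs
begin

text \<open>
  Write \<open>A = {X\<^sub>0 > u}\<close> and \<open>B = {X\<^sub>t > v}\<close>. The covariance of the two indicators is
  \<open>P(A \<inter> B) - P(A) P(B)\<close>, and \<open>A\<close> and \<open>B\<close> belong to the \<open>\<sigma>\<close>-algebras generated by the single
  variables \<open>X\<^sub>0\<close> and \<open>X\<^sub>t\<close>. Each of the five coefficients controls this quantity for all events of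
  its two \<open>\<sigma>\<close>-algebras, at the price of a factor at most \<open>2\<close> (lemma \<open>dependence_le_mixing_coeff\<close>;
  the factor comes from the \<open>1/2\<close> in the definition of \<open>\<beta>\<close>). Since \<open>{0}\<close> and \<open>{t}\<close> have Hausdorff
  distance \<open>N t\<close>, they compete in the supremum that defines \<open>z\<^sub>X(N t, 1, 1)\<close>. This gives a bound
  \<open>\<bar>Cov\<^sub>X(t, u, v)\<bar> \<le> 2 z\<^sub>X(N t, 1, 1)\<close> that is uniform in the levels \<open>u\<close> and \<open>v\<close>.
  Integrating the constant \<open>2 z\<^sub>X(N t, 1, 1)\<close> over \<open>\<mu> \<Otimes> \<mu>\<close> multiplies it by \<open>\<mu>(\<real>)\<^sup>2\<close>, and
  integrating over \<open>t\<close> gives the claim, even with \<open>2\<close> in place of \<open>8\<close>.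

  The index set may be a non-measurable subset of the space, so the integrands in \<open>t\<close> need not be
  measurable. What is needed of the integral is only that it is monotone and that finite
  constants can be pulled out, and both hold for arbitrary nonnegative functions.
\<close>

section \<open>Integrals of arbitrary nonnegative functions\<close>

text \<open>The integral is the supremum of the integrals of simple minorants, and dividing a simple
  minorant of \<open>c f\<close> by \<open>c\<close> gives one of \<open>f\<close>. Unlike the library rule \<open>nn_integral_cmult\<close>, this
  applies when \<open>f\<close> is not measurable.\<close>

lemma nn_integral_cmult_le:
  fixes c :: ennreal
  assumes "c < \<infinity>"
  shows "(\<integral>\<^sup>+x. c * f x \<partial>M) \<le> c * (\<integral>\<^sup>+x. f x \<partial>M)"
proof (cases "c = 0")
  case False
  have "integral\<^sup>S M g \<le> c * (\<integral>\<^sup>+x. f x \<partial>M)"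
    if g: "simple_function M g" and le: "g \<le> (\<lambda>x. c * f x)" for g
  proof -
    have [measurable]: "g \<in> borel_measurable M"
      using g by (rule borel_measurable_simple_function)
    have scale: "c * (g x / c) = g x" for x
      using False assms
      by (simp add: ennreal_times_divide ennreal_mult_divide_eq mult.commute[of c])
    have "g x / c \<le> f x" for x
    proof -
      have "g x / c \<le> (f x * c) / c"
        using le by (intro divide_right_mono_ennreal) (simp add: le_fun_def mult.commute)
      also have "\<dots> = f x"
        using False assms by (simp add: ennreal_mult_divide_eq)
      finally show ?thesis .
    qed
    then have "(\<integral>\<^sup>+x. g x / c \<partial>M) \<le> (\<integral>\<^sup>+x. f x \<partial>M)"
      by (rule nn_integral_mono)
    moreover have "integral\<^sup>S M g = c * (\<integral>\<^sup>+x. g x / c \<partial>M)"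
      using g by (simp add: nn_integral_eq_simple_integral[symmetric]
          nn_integral_cmult[symmetric] scale)
    ultimately show ?thesis
      by (simp add: mult_left_mono)
  qed
  then show ?thesis
    unfolding nn_integral_def[of M "\<lambda>x. c * f x"] by (auto intro!: SUP_least)
qed simp

lemma index_integral_mono:
  assumes "\<And>t. t \<in> T \<Longrightarrow> f t \<le> g t"
  shows "index_integral T f \<le> index_integral T g"
  unfolding index_integral_def
  by (auto intro!: nn_integral_mono assms split: split_indicator)

lemma index_integral_cmult_le:
  assumes "c < \<infinity>"
  shows "index_integral T (\<lambda>t. c * f t) \<le> c * index_integral T f"
  using nn_integral_cmult_le[OF assms, where f = f]
    nn_integral_cmult_le[OF assms, where f = "\<lambda>t. f t * indicator T t"]
  by (simp add: index_integral_def mult.assoc)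

section \<open>Mixing coefficients and the dependence of two events\<close>

lemma (in prob_space) covariance_of_bool:
  assumes [measurable]: "Measurable.pred M P" "Measurable.pred M Q"
  shows "covariance M (\<lambda>\<omega>. of_bool (P \<omega>)) (\<lambda>\<omega>. of_bool (Q \<omega>)) =
    prob ({\<omega>\<in>space M. P \<omega>} \<inter> {\<omega>\<in>space M. Q \<omega>})
      - prob {\<omega>\<in>space M. P \<omega>} * prob {\<omega>\<in>space M. Q \<omega>}"
proof -
  let ?A = "{\<omega>\<in>space M. P \<omega>}" and ?B = "{\<omega>\<in>space M. Q \<omega>}"
  have eP: "(\<integral>\<omega>. of_bool (P \<omega>) \<partial>M) = prob ?A"
    by (subst Bochner_Integration.integral_cong[where g = "indicator ?A"])
      (auto simp: indicator_def)
  have eQ: "(\<integral>\<omega>. of_bool (Q \<omega>) \<partial>M) = prob ?B"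
    by (subst Bochner_Integration.integral_cong[where g = "indicator ?B"])
      (auto simp: indicator_def)
  have "covariance M (\<lambda>\<omega>. of_bool (P \<omega>)) (\<lambda>\<omega>. of_bool (Q \<omega>)) =
    (\<integral>\<omega>. indicator (?A \<inter> ?B) \<omega> - prob ?B * indicator ?A \<omega> - prob ?A * indicator ?B \<omega>
        + prob ?A * prob ?B \<partial>M)"
    unfolding covariance_def eP eQ
    by (rule Bochner_Integration.integral_cong) (auto simp: indicator_def algebra_simps)
  also have "\<dots> = prob (?A \<inter> ?B) - prob ?A * prob ?B"
  proof -
    have "(\<integral>\<omega>. indicator (A \<inter> B) \<omega> - prob B * indicator A \<omega> - prob A * indicator B \<omega>
        + prob A * prob B \<partial>M) = prob (A \<inter> B) - prob A * prob B"
      if "A \<in> events" "B \<in> events" for A B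
    proof -
      have "integrable M (indicator C :: 'a \<Rightarrow> real)" if "C \<in> events" for C
        using that by (simp add: less_top[symmetric])
      with that show ?thesis
        by (simp add: sets.Int prob_space)
    qed
    then show ?thesis
      by measurable
  qed
  finally show ?thesis .
qed

lemma (in prob_space) covariance_indicator:
  assumes "A \<in> events" "B \<in> events"
  shows "covariance M (indicator A) (indicator B) = prob (A \<inter> B) - prob A * prob B"
proof -
  have "{\<omega>\<in>space M. \<omega> \<in> A} = A" "{\<omega>\<in>space M. \<omega> \<in> B} = B"
    using assms by (auto dest: sets.sets_into_space)
  moreover have "indicator C = (\<lambda>\<omega>. of_bool (\<omega> \<in> C) :: real)" for C :: "'a set"
    by (auto simp: indicator_def)
  ultimately show ?thesis
    using covariance_of_bool[of "\<lambda>\<omega>. \<omega> \<in> A" "\<lambda>\<omega>. \<omega> \<in> B"] assms by simp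
qed

lemma event_partition:
  assumes C: "C \<in> sets F"
  shows "{C, space F - C} - {{}} \<subseteq> sets F" "partition_on (space F) ({C, space F - C} - {{}})"
proof -
  show "{C, space F - C} - {{}} \<subseteq> sets F"
    using C sets.compl_sets[OF C] by blast
  have "C \<subseteq> space F"
    using C by (rule sets.sets_into_space)
  then show "partition_on (space F) ({C, space F - C} - {{}})"
  proof (intro partition_onI)
    have *: "pairwise disjnt {C, space F - C}"
      by (auto simp: pairwise_insert disjnt_def)
    show "disjnt p q"
      if "p \<in> {C, space F - C} - {{}}" "q \<in> {C, space F - C} - {{}}" "p \<noteq> q" for p q
      using that by (elim DiffE) (rule pairwiseD[OF *])
  qed auto
qed

context prob_space
begin

context
  fixes U V :: "'a measure" and A B :: "'a set"
  assumes A: "A \<in> sets U" "A \<in> events" and B: "B \<in> sets V" "B \<in> events"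
begin

lemma dependence_le_alpha_mixing:
  "ennreal \<bar>prob (A \<inter> B) - prob A * prob B\<bar> \<le> alpha_mixing M U V"
  unfolding alpha_mixing_def using A B by (intro SUP_upper2[of "(A, B)"]) auto

text \<open>The dependence of \<open>A\<close> and \<open>B\<close> is one term of the sum for the partitions
  \<open>{A, \<Omega> - A}\<close> and \<open>{B, \<Omega> - B}\<close>, from which an empty block has to be removed.\<close>

lemma dependence_le_beta_mixing:
  assumes sp: "space U = space M" "space V = space M"
  shows "ennreal \<bar>prob (A \<inter> B) - prob A * prob B\<bar> \<le> 2 * beta_mixing M U V"
proof (cases "A = {} \<or> B = {}")
  case False
  define P where "P = {A, space M - A} - {{}}"
  define Q where "Q = {B, space M - B} - {{}}"
  let ?d = "\<lambda>A B. \<bar>prob (A \<inter> B) - prob A * prob B\<bar>"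
  have P: "finite P" "P \<subseteq> sets U" "partition_on (space M) P" "A \<in> P"
    unfolding P_def using event_partition[OF A(1)] False by (simp_all add: sp)
  have Q: "finite Q" "Q \<subseteq> sets V" "partition_on (space M) Q" "B \<in> Q"
    unfolding Q_def using event_partition[OF B(1)] False by (simp_all add: sp)
  have "?d A B \<le> (\<Sum>B'\<in>Q. ?d A B')"
    using Q by (intro member_le_sum) auto
  also have "\<dots> \<le> (\<Sum>A'\<in>P. \<Sum>B'\<in>Q. ?d A' B')"
    using P by (intro member_le_sum[where f = "\<lambda>A'. \<Sum>B'\<in>Q. ?d A' B'"] sum_nonneg) auto
  finally have "ennreal (?d A B) \<le> ennreal (\<Sum>A'\<in>P. \<Sum>B'\<in>Q. ?d A' B')"
    by (rule ennreal_leI)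
  also have "\<dots> \<le> 2 * beta_mixing M U V"
    unfolding beta_mixing_def ennreal_times_divide
    using P Q
    by (subst mult.commute, subst ennreal_mult_divide_eq) (auto intro!: SUP_upper2[of "(P, Q)"])
  finally show ?thesis .
qed auto

text \<open>Multiplying the conditional deviation \<open>P(B) - P(B | A)\<close> by \<open>P(A) \<le> 1\<close> gives the dependence;
  it vanishes if \<open>P(A) = 0\<close>.\<close>

lemma dependence_le_phi_mixing:
  "ennreal \<bar>prob (A \<inter> B) - prob A * prob B\<bar> \<le> phi_mixing M U V"
proof (cases "prob A = 0")
  case True
  then have "prob (A \<inter> B) = 0"
    using A finite_measure_mono[of "A \<inter> B" A] by (simp add: measure_le_0_iff)
  with True show ?thesis by simp
next
  case False
  then have pos: "prob A > 0"
    by (simp add: zero_less_measure_iff)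
  have "\<bar>prob (A \<inter> B) - prob A * prob B\<bar> = prob A * \<bar>prob B - prob (A \<inter> B) / prob A\<bar>"
  proof -
    have "prob (A \<inter> B) - prob A * prob B = - (prob A * (prob B - prob (A \<inter> B) / prob A))"
      using pos by (simp add: right_diff_distrib)
    then show ?thesis
      by (simp only: abs_minus_cancel abs_mult abs_of_pos[OF pos])
  qed
  also have "\<dots> \<le> \<bar>prob B - prob (A \<inter> B) / prob A\<bar>"
    by (intro mult_left_le_one_le) auto
  finally have "ennreal \<bar>prob (A \<inter> B) - prob A * prob B\<bar>
      \<le> ennreal \<bar>prob B - prob (A \<inter> B) / prob A\<bar>"
    by (rule ennreal_leI)
  also have "\<dots> \<le> phi_mixing M U V"
    unfolding phi_mixing_def using A B pos by (intro SUP_upper2[of "(A, B)"]) auto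
  finally show ?thesis .
qed

lemma dependence_le_psi_mixing:
  "ennreal \<bar>prob (A \<inter> B) - prob A * prob B\<bar> \<le> psi_mixing M U V"
proof (cases "prob A * prob B = 0")
  case True
  then have "prob (A \<inter> B) = 0"
    using A B finite_measure_mono[of "A \<inter> B" A] finite_measure_mono[of "A \<inter> B" B]
    by (auto simp: measure_le_0_iff)
  then show ?thesis by (simp only: True) simp
next
  case False
  let ?p = "prob A * prob B"
  have pos: "?p > 0"
    using False by (metis measure_nonneg mult_nonneg_nonneg order_le_less)
  have "\<bar>prob (A \<inter> B) - ?p\<bar> = ?p * \<bar>1 - prob (A \<inter> B) / ?p\<bar>"
  proof -
    have "prob (A \<inter> B) - ?p = - (?p * (1 - prob (A \<inter> B) / ?p))"
      using False by (simp add: right_diff_distrib del: mult_eq_0_iff)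
    then show ?thesis
      by (simp only: abs_minus_cancel abs_mult[of ?p] abs_of_pos[OF pos])
  qed
  also have "\<dots> \<le> \<bar>1 - prob (A \<inter> B) / ?p\<bar>"
    by (intro mult_left_le_one_le) (auto intro: mult_le_one)
  finally have "ennreal \<bar>prob (A \<inter> B) - ?p\<bar> \<le> ennreal \<bar>1 - prob (A \<inter> B) / ?p\<bar>"
    by (rule ennreal_leI)
  also have "\<dots> \<le> psi_mixing M U V"
    unfolding psi_mixing_def using A B pos by (intro SUP_upper2[of "(A, B)"]) auto
  finally show ?thesis .
qed

text \<open>The dependence of \<open>A\<close> and \<open>B\<close> is the covariance of their indicators, whose variances
  \<open>P(A) (1 - P(A))\<close> and \<open>P(B) (1 - P(B))\<close> are at most \<open>1\<close>, so passing to the correlation only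
  increases it. If a variance vanishes, the event is trivial and the dependence is \<open>0\<close>.\<close>

lemma dependence_le_rho_mixing:
  "ennreal \<bar>prob (A \<inter> B) - prob A * prob B\<bar> \<le> rho_mixing M U V"
proof -
  let ?c = "covariance M"
  let ?v = "\<lambda>C. prob C * (1 - prob C)"
  have dep: "?c (indicator A) (indicator B) = prob (A \<inter> B) - prob A * prob B"
    using A B by (intro covariance_indicator)
  have var: "?c (indicator C) (indicator C) = ?v C" if "C \<in> events" for C
    using covariance_indicator[OF that that] by (simp add: algebra_simps)
  have v: "0 \<le> ?v C" "?v C \<le> 1" for C
    by (auto intro: mult_le_one)
  have "\<bar>?c (indicator A) (indicator B)\<bar> \<le> \<bar>correlation M (indicator A) (indicator B)\<bar>"
  proof (cases "?v A * ?v B = 0")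
    case True
    then consider "prob A = 0" | "prob A = 1" | "prob B = 0" | "prob B = 1"
      by auto
    then have "prob (A \<inter> B) = prob A * prob B"
    proof cases
      case 1
      then show ?thesis
        using A finite_measure_mono[of "A \<inter> B" A] by (simp add: measure_le_0_iff)
    next
      case 2
      moreover from this have "prob (A \<inter> B) = prob B"
        using A B by (auto simp: prob_eq_1 intro!: measure_eq_AE)
      ultimately show ?thesis
        by simp
    next
      case 3
      then show ?thesis
        using B finite_measure_mono[of "A \<inter> B" B] by (simp add: measure_le_0_iff)
    next
      case 4
      moreover from this have "prob (A \<inter> B) = prob A"
        using A B by (auto simp: prob_eq_1 intro!: measure_eq_AE)
      ultimately show ?thesis
        by simp
    qed
    then show ?thesis
      by (simp add: dep)
  next
    case False
    let ?s = "sqrt (?v A * ?v B)"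
    have "?v A * ?v B > 0"
      using False v[of A] v[of B] by (metis mult_nonneg_nonneg order_le_less)
    then have s: "0 < ?s" "?s \<le> 1"
      using v[of A] v[of B] by (auto intro: mult_le_one)
    have "\<bar>?c (indicator A) (indicator B)\<bar> \<le> \<bar>?c (indicator A) (indicator B)\<bar> / ?s"
      using s mult_left_mono[of ?s 1 "\<bar>?c (indicator A) (indicator B)\<bar>"]
      by (simp add: pos_le_divide_eq)
    also have "\<dots> = \<bar>correlation M (indicator A) (indicator B)\<bar>"
      using s A B by (simp add: correlation_def var abs_divide)
    finally show ?thesis .
  qed
  then have "ennreal \<bar>prob (A \<inter> B) - prob A * prob B\<bar>
      \<le> ennreal \<bar>correlation M (indicator A) (indicator B)\<bar>"
    by (intro ennreal_leI) (simp add: dep)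
  also have "\<dots> \<le> rho_mixing M U V"
  proof -
    have "integrable M (\<lambda>\<omega>. (indicator C \<omega> :: real)\<^sup>2)" if "C \<in> events" for C
      using that by (intro integrable_const_bound[where B = 1]) (auto simp: indicator_def)
    then show ?thesis
      unfolding rho_mixing_def using A B
      by (intro SUP_upper2[of "(indicator A, indicator B)"]) auto
  qed
  finally show ?thesis .
qed

lemma dependence_le_mixing_coeff:
  assumes "space U = space M" "space V = space M"
  shows "ennreal \<bar>prob (A \<inter> B) - prob A * prob B\<bar> \<le> 2 * mixing_coeff z M U V"
proof -
  have double: "x \<le> 2 * y" if "x \<le> y" for x y :: ennreal
    using that by (metis add_increasing2 mult_2 zero_le)
  show ?thesis
    by (cases z) (simp_all add: double dependence_le_alpha_mixing
        dependence_le_beta_mixing[OF assms] dependence_le_phi_mixing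
        dependence_le_psi_mixing dependence_le_rho_mixing)
qed

end

end

section \<open>Exceedance events of a random field\<close>

lemma field_sigma_measurable:
  assumes "t \<in> C" "S \<in> sets borel"
  shows "X t -` S \<inter> space M \<in> sets (field_sigma M X C)"
  unfolding field_sigma_def using assms by (subst sets_measure_of) auto

lemma space_field_sigma [simp]: "space (field_sigma M X C) = space M"
  unfolding field_sigma_def by (subst space_measure_of) auto

lemma hausdorff_distance_singletons:
  "hausdorff_distance N {a} {b} = N (a - b)"
  by (simp add: hausdorff_distance_def)

lemma mixing_coeff_singletons_le_field_mixing:
  assumes "is_norm N" "0 \<in> T" "t \<in> T"
  shows "mixing_coeff z M (field_sigma M X {0}) (field_sigma M X {t})
    \<le> field_mixing z N M T X (N t) 1 1"
proof -
  have "N (- t) = N t"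
    using assms(1) unfolding is_norm_def by (metis abs_1 abs_minus_cancel mult_1 scaleR_minus1_left)
  then show ?thesis
    unfolding field_mixing_def using assms(2,3)
    by (intro SUP_upper2[of "({0}, {t})"]) (auto simp: hausdorff_distance_singletons)
qed

lemma Cov_field_le_field_mixing:
  assumes "prob_space M" "is_norm N" "random_field M T X" "0 \<in> T" "t \<in> T"
  shows "ennreal \<bar>Cov_field M X t u v\<bar> \<le> 2 * field_mixing z N M T X (N t) 1 1"
proof -
  interpret prob_space M by fact
  have [measurable]: "X 0 \<in> borel_measurable M" "X t \<in> borel_measurable M"
    using assms(3-5) by (auto simp: random_field_def)
  let ?A = "{\<omega>\<in>space M. X 0 \<omega> > u}" and ?B = "{\<omega>\<in>space M. X t \<omega> > v}"
  have "?A = X 0 -` {u<..} \<inter> space M" "?B = X t -` {v<..} \<inter> space M"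
    by auto
  then have gen: "?A \<in> sets (field_sigma M X {0})" "?B \<in> sets (field_sigma M X {t})"
    by (auto intro!: field_sigma_measurable)
  have "ennreal \<bar>Cov_field M X t u v\<bar> = ennreal \<bar>prob (?A \<inter> ?B) - prob ?A * prob ?B\<bar>"
    unfolding Cov_field_def by (subst covariance_of_bool) auto
  also have "\<dots> \<le> 2 * mixing_coeff z M (field_sigma M X {0}) (field_sigma M X {t})"
    using gen by (intro dependence_le_mixing_coeff) auto
  also have "\<dots> \<le> 2 * field_mixing z N M T X (N t) 1 1"
    using assms by (intro mult_left_mono mixing_coeff_singletons_le_field_mixing) auto
  finally show ?thesis .
qed

section \<open>Short range dependence\<close>

lemma emeasure_pair_UNIV:
  assumes "finite_borel_measure \<mu>"
  shows "emeasure (\<mu> \<Otimes>\<^sub>M \<mu>) (space (\<mu> \<Otimes>\<^sub>M \<mu>)) = (emeasure \<mu> UNIV)\<^sup>2"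
proof -
  interpret finite_borel_measure \<mu> by fact
  have "space \<mu> = UNIV"
    using M_is_borel by (metis sets_eq_imp_space_eq space_borel)
  then show ?thesis
    using emeasure_pair_measure_Times[of "space \<mu>" \<mu> "space \<mu>"] sets.top[of \<mu>]
    by (simp add: space_pair_measure power2_eq_square)
qed

theorem theorem3p3:
  fixes M :: "'w measure"
    and T :: "(real ^ 'n) set"
    and N :: "real ^ 'n \<Rightarrow> real"
    and X :: "real ^ 'n \<Rightarrow> 'w \<Rightarrow> real"
    and z :: mixing_type
  assumes "prob_space M"
    and "\<not> bounded T" and "0 \<in> T"
    and "is_norm N"
    and "stationary_field M T X"
    and "index_integral T (\<lambda>t. field_mixing z N M T X (N t) 1 1) < \<infinity>"
  shows "short_range_dependent M T X \<and>
    (\<forall>\<mu>. finite_borel_measure \<mu> \<longrightarrow>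
      index_integral T (\<lambda>t. \<integral>\<^sup>+ (u, v). ennreal \<bar>Cov_field M X t u v\<bar> \<partial>(\<mu> \<Otimes>\<^sub>M \<mu>))
        \<le> 8 * index_integral T (\<lambda>t. field_mixing z N M T X (N t) 1 1) * (emeasure \<mu> UNIV)\<^sup>2 \<and>
      8 * index_integral T (\<lambda>t. field_mixing z N M T X (N t) 1 1) * (emeasure \<mu> UNIV)\<^sup>2 < \<infinity>)"
proof -
  let ?z = "\<lambda>t. field_mixing z N M T X (N t) 1 1"
  let ?I = "index_integral T ?z"
  have rf: "random_field M T X"
    using assms(5) by (simp add: stationary_field_def)
  have bound: "index_integral T (\<lambda>t. \<integral>\<^sup>+ (u, v). ennreal \<bar>Cov_field M X t u v\<bar> \<partial>(\<mu> \<Otimes>\<^sub>M \<mu>))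
      \<le> 8 * ?I * (emeasure \<mu> UNIV)\<^sup>2"
    and fin: "8 * ?I * (emeasure \<mu> UNIV)\<^sup>2 < \<infinity>"
    if \<mu>: "finite_borel_measure \<mu>" for \<mu>
  proof -
    interpret finite_borel_measure \<mu> by fact
    let ?m = "(emeasure \<mu> UNIV)\<^sup>2"
    have m: "?m < \<infinity>"
      by (simp add: power2_eq_square ennreal_mult_less_top less_top[symmetric] ennreal_mult_eq_top_iff)
    have "(\<integral>\<^sup>+ (u, v). ennreal \<bar>Cov_field M X t u v\<bar> \<partial>(\<mu> \<Otimes>\<^sub>M \<mu>)) \<le> (2 * ?m) * ?z t"
      if "t \<in> T" for t
    proof -
      have "(\<integral>\<^sup>+ (u, v). ennreal \<bar>Cov_field M X t u v\<bar> \<partial>(\<mu> \<Otimes>\<^sub>M \<mu>))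
          \<le> (\<integral>\<^sup>+ _. 2 * ?z t \<partial>(\<mu> \<Otimes>\<^sub>M \<mu>))"
        by (intro nn_integral_mono)
          (auto simp del: One_nat_def intro: Cov_field_le_field_mixing assms(1,4,3) rf that)
      also have "\<dots> = (2 * ?m) * ?z t"
        by (simp add: emeasure_pair_UNIV[OF \<mu>] mult_ac)
      finally show ?thesis .
    qed
    then have "index_integral T (\<lambda>t. \<integral>\<^sup>+ (u, v). ennreal \<bar>Cov_field M X t u v\<bar> \<partial>(\<mu> \<Otimes>\<^sub>M \<mu>))
        \<le> index_integral T (\<lambda>t. (2 * ?m) * ?z t)"
      by (rule index_integral_mono)
    also have "\<dots> \<le> (2 * ?m) * ?I"
      using m by (intro index_integral_cmult_le) (simp add: ennreal_mult_less_top)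
    also have "\<dots> = 2 * (?I * ?m)"
      by (simp add: mult_ac)
    also have "\<dots> \<le> 8 * (?I * ?m)"
      by (intro mult_right_mono) auto
    finally show "index_integral T (\<lambda>t. \<integral>\<^sup>+ (u, v). ennreal \<bar>Cov_field M X t u v\<bar> \<partial>(\<mu> \<Otimes>\<^sub>M \<mu>))
        \<le> 8 * ?I * ?m"
      by (simp add: mult.assoc)
    show "8 * ?I * ?m < \<infinity>"
      using m assms(6) by (simp add: ennreal_mult_less_top)
  qed
  have "short_range_dependent M T X"
    unfolding short_range_dependent_def sigma2_def
    using bound fin by (blast intro: order.strict_trans1)
  with bound fin show ?thesis
    by blast
qed

end
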